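(* Let $A,B,S,T$ be finite sets and $\Gamma=A\times B\times S\times T$. For a correlation $P\in\mathbb{R}^\Gamma$ we have $A_q(P)=1$ if and only if $P\in C_{loc}(\Gamma)$.
   Context: A (bipartite) correlation is a vector $P=(P(a,b|s,t))\in\mathbb{R}^\Gamma$ with $P(a,b|s,t)\ge 0$ for all $(a,b,s,t)\in\Gamma$ and $\sum_{a,b}P(a,b|s,t)=1$ for all $(s,t)\in S\times T$. A correlation is deterministic if $P(a,b|s,t)=P_A(a|s)P_B(b|t)$ with $P_A(a|s),P_B(b|t)\in\{0,1\}$ and $\sum_aP_A(a|s)=\sum_bP_B(b|t)=1$ for all $s,t$. The set $C_{loc}(\Gamma)$ of classical correlations is the convex hull of the deterministic correlations. For $d\in\mathbb{N}$, $C_q^d(\Gamma)$ is the set of correlations of the form $P(a,b|s,t)=\psi^*(E_s^a\otimes F_t^b)\psi$, where $\psi\in\mathbb{C}^d\otimes\mathbb{C}^d$ is a unit vector and, for all $s\in S$, $t\in T$, $\{E_s^a\}_{a\in A}$ and $\{F_t^b\}_{b\in B}$ are families of $d\times d$ Hermitian positive semidefinite matrices summing to the identity. Set $C_q(\Gamma)=\bigcup_{d\in\mathbb{N}}C_q^d(\Gamma)$ and, for $P\in C_q(\Gamma)$, $D_q(P)=\min\{d^2: d\in\mathbb{N},\ P\in C_q^d(\Gamma)\}$. The minimal average entanglement dimension is $$A_q(P)=\inf\Big\{\sum_{i=1}^I\lambda_iD_q(P_i): I\in\mathbb{N},\ \lambda\in\mathbb{R}_+^I,\ \sum_{i=1}^I\lambda_i=1,\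 P=\sum_{i=1}^I\lambda_iP_i,\ P_i\in C_q(\Gamma)\Big\},$$ with the usual convention $\inf\emptyset=+\infty$. *)

theory Defs
  imports
    "HOL-Analysis.Analysis"
    "HOL-Library.Function_Algebras"
    "Jordan_Normal_Form.Schur_Decomposition"
begin

text \<open>
  The pointwise real vector space structure on functions; addition is the one of
  \<^theory>\<open>HOL-Library.Function_Algebras\<close>.
\<close>

instantiation "fun" :: (type, real_vector) real_vector
begin

definition scaleR_fun :: "real \<Rightarrow> ('a \<Rightarrow> 'b) \<Rightarrow> 'a \<Rightarrow> 'b" where
  "scaleR_fun c f = (\<lambda>x. c *\<^sub>R f x)"

instance
  by standard (simp_all add: scaleR_fun_def fun_eq_iff scaleR_add_right scaleR_add_left)

end

lemma scaleR_fun_apply [simp]: "(c *\<^sub>R f) x = c *\<^sub>R f x"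
  by (simp add: scaleR_fun_def)

definition Gam :: "'a set \<Rightarrow> 'b set \<Rightarrow> 's set \<Rightarrow> 't set \<Rightarrow> ('a \<times> 'b \<times> 's \<times> 't) set" where
  "Gam A B S T = A \<times> B \<times> S \<times> T"

text \<open>
  The space \<open>\<real>\<^sup>\<Gamma>\<close> is represented by the functions on the whole type that vanish outside
  \<open>\<Gamma>\<close>; this is a linear subspace, so that equalities and convex combinations of
  functions are exactly those of \<open>\<real>\<^sup>\<Gamma>\<close>.  The value \<open>P(a,b|s,t)\<close> is \<open>P (a, b, s, t)\<close>.
\<close>

definition vectors_on :: "'x set \<Rightarrow> ('x \<Rightarrow> real) set" where
  "vectors_on X = {P. \<forall>x. x \<notin> X \<longrightarrow> P x = 0}"

definition correlations ::
  "'a set \<Rightarrow> 'b set \<Rightarrow> 's set \<Rightarrow> 't set \<Rightarrow> ('a \<times> 'b \<times> 's \<times> 't \<Rightarrow> real) set" where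
  "correlations A B S T = {P \<in> vectors_on (Gam A B S T).
     (\<forall>x\<in>Gam A B S T. 0 \<le> P x) \<and>
     (\<forall>s\<in>S. \<forall>t\<in>T. (\<Sum>a\<in>A. \<Sum>b\<in>B. P (a, b, s, t)) = 1)}"

definition deterministic_correlations ::
  "'a set \<Rightarrow> 'b set \<Rightarrow> 's set \<Rightarrow> 't set \<Rightarrow> ('a \<times> 'b \<times> 's \<times> 't \<Rightarrow> real) set" where
  "deterministic_correlations A B S T = {P \<in> correlations A B S T.
     \<exists>(PA :: 'a \<Rightarrow> 's \<Rightarrow> real) (PB :: 'b \<Rightarrow> 't \<Rightarrow> real).
       (\<forall>s\<in>S. \<forall>a\<in>A. PA a s \<in> {0, 1}) \<and> (\<forall>s\<in>S. (\<Sum>a\<in>A. PA a s) = 1) \<and>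
       (\<forall>t\<in>T. \<forall>b\<in>B. PB b t \<in> {0, 1}) \<and> (\<forall>t\<in>T. (\<Sum>b\<in>B. PB b t) = 1) \<and>
       (\<forall>a\<in>A. \<forall>b\<in>B. \<forall>s\<in>S. \<forall>t\<in>T. P (a, b, s, t) = PA a s * PB b t)}"

definition C_loc ::
  "'a set \<Rightarrow> 'b set \<Rightarrow> 's set \<Rightarrow> 't set \<Rightarrow> ('a \<times> 'b \<times> 's \<times> 't \<Rightarrow> real) set" where
  "C_loc A B S T = convex hull deterministic_correlations A B S T"

text \<open>
  The space \<open>\<complex>\<^sup>d \<otimes> \<complex>\<^sup>d\<close> is \<open>carrier_vec (d * d)\<close>, the basis vector
  \<open>e\<^sub>i \<otimes> e\<^sub>k\<close> having index \<open>i * d + k\<close>; \<open>tensor_mat\<close> is the Kronecker product.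
\<close>

definition tensor_mat :: "complex mat \<Rightarrow> complex mat \<Rightarrow> complex mat" where
  "tensor_mat M N = mat (dim_row M * dim_row N) (dim_col M * dim_col N)
     (\<lambda>(i, j). M $$ (i div dim_row N, j div dim_col N) * N $$ (i mod dim_row N, j mod dim_col N))"

text \<open>
  Since \<open>v \<bullet>c w\<close> conjugates \<open>w\<close>, the number \<open>v\<^sup>* M v\<close> is \<open>(M *\<^sub>v v) \<bullet>c v\<close>.
  In the order on \<^typ>\<open>complex\<close>, \<open>0 \<le> z\<close> says that \<open>z\<close> is a nonnegative real.
\<close>

definition hermitian_psd :: "nat \<Rightarrow> complex mat \<Rightarrow> bool" where
  "hermitian_psd d M \<longleftrightarrow> M \<in> carrier_mat d d \<and> mat_adjoint M = M \<and>
     (\<forall>v\<in>carrier_vec d. 0 \<le> (M *\<^sub>v v) \<bullet>c v)"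

definition povm :: "nat \<Rightarrow> 'x set \<Rightarrow> ('x \<Rightarrow> complex mat) \<Rightarrow> bool" where
  "povm d X E \<longleftrightarrow> (\<forall>x\<in>X. hermitian_psd d (E x)) \<and>
     mat d d (\<lambda>ij. \<Sum>x\<in>X. E x $$ ij) = 1\<^sub>m d"

text \<open>For \<open>d = 0\<close> the following set is empty, as there is no unit vector.\<close>

definition C_qd ::
  "nat \<Rightarrow> 'a set \<Rightarrow> 'b set \<Rightarrow> 's set \<Rightarrow> 't set \<Rightarrow> ('a \<times> 'b \<times> 's \<times> 't \<Rightarrow> real) set" where
  "C_qd d A B S T = {P \<in> correlations A B S T.
     \<exists>(\<psi> :: complex vec) (E :: 's \<Rightarrow> 'a \<Rightarrow> complex mat) (F :: 't \<Rightarrow> 'b \<Rightarrow> complex mat).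
       \<psi> \<in> carrier_vec (d * d) \<and> \<psi> \<bullet>c \<psi> = 1 \<and>
       (\<forall>s\<in>S. povm d A (E s)) \<and> (\<forall>t\<in>T. povm d B (F t)) \<and>
       (\<forall>a\<in>A. \<forall>b\<in>B. \<forall>s\<in>S. \<forall>t\<in>T.
          complex_of_real (P (a, b, s, t)) = (tensor_mat (E s a) (F t b) *\<^sub>v \<psi>) \<bullet>c \<psi>)}"

definition C_q ::
  "'a set \<Rightarrow> 'b set \<Rightarrow> 's set \<Rightarrow> 't set \<Rightarrow> ('a \<times> 'b \<times> 's \<times> 't \<Rightarrow> real) set" where
  "C_q A B S T = (\<Union>d. C_qd d A B S T)"

text \<open>Meaningful only for \<open>P \<in> C_q A B S T\<close>, where the minimum exists.\<close>

definition D_q ::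
  "'a set \<Rightarrow> 'b set \<Rightarrow> 's set \<Rightarrow> 't set \<Rightarrow> ('a \<times> 'b \<times> 's \<times> 't \<Rightarrow> real) \<Rightarrow> nat" where
  "D_q A B S T P = (LEAST n. \<exists>d. n = d\<^sup>2 \<and> P \<in> C_qd d A B S T)"

text \<open>In \<^typ>\<open>ereal\<close> the infimum of the empty set is \<open>\<infinity>\<close>.\<close>

definition A_q ::
  "'a set \<Rightarrow> 'b set \<Rightarrow> 's set \<Rightarrow> 't set \<Rightarrow> ('a \<times> 'b \<times> 's \<times> 't \<Rightarrow> real) \<Rightarrow> ereal" where
  "A_q A B S T P = Inf {ereal (\<Sum>i<I. lam i * real (D_q A B S T (Q i))) |
     (I :: nat) (lam :: nat \<Rightarrow> real) (Q :: nat \<Rightarrow> 'a \<times> 'b \<times> 's \<times> 't \<Rightarrow> real).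
       (\<forall>i<I. 0 \<le> lam i) \<and> (\<Sum>i<I. lam i) = 1 \<and>
       P = (\<Sum>i<I. lam i *\<^sub>R Q i) \<and> (\<forall>i<I. Q i \<in> C_q A B S T)}"

end

theory Submission
  imports Defs
begin

text \<open>
  For \<open>d = 1\<close> the quantum model is a product of two local distributions, and such a product is
  the average of the deterministic correlations over independently drawn functions
  \<open>S \<rightarrow> A\<close> and \<open>T \<rightarrow> B\<close>; conversely deterministic correlations have \<open>D_q = 1\<close>.  All other
  values of \<open>D_q\<close> are at least 4, so a decomposition with average at most \<open>1 + \<epsilon>\<close> puts
  weight at most \<open>\<epsilon> / 3\<close> outside \<open>C_loc\<close>.  Hence \<open>A_q = 1\<close> puts \<open>P\<close> into the closure of
  \<open>C_loc\<close>, which is compact, being the convex hull of a finite set.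
\<close>

section \<open>Compactness and closedness of the classical set\<close>

text \<open>Induction on \<open>F\<close>: every point of the hull of \<open>insert f F\<close> lies
  on a segment from \<open>f\<close> to a point of the hull of \<open>F\<close>. So the hull is the
  image of a product of two compact sets under a map that is continuous in the product topology on
  functions.\<close>

lemma compact_convex_hull_finite_fun:
  fixes F :: "('x \<Rightarrow> real) set"
  assumes "finite F"
  shows "compact (convex hull F)"
  using assms
proof induction
  case empty
  then show ?case by simp
next
  case (insert f F)
  show ?case
  proof (cases "F = {}")
    case True
    then show ?thesis by simp
  next
    case False
    let ?h = "\<lambda>p :: real \<times> ('x \<Rightarrow> real). fst p *\<^sub>R f + (1 - fst p) *\<^sub>R snd p"
    have eq: "convex hull (insert f F) = ?h ` ({0..1} \<times> (convex hull F))"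
    proof (intro equalityI subsetI)
      fix x
      assume "x \<in> convex hull (insert f F)"
      then obtain u v b where "0 \<le> u" "0 \<le> v" "b \<in> convex hull F" "u + v = 1"
        "x = u *\<^sub>R f + v *\<^sub>R b"
        unfolding convex_hull_insert[OF False] by auto
      moreover from \<open>u + v = 1\<close> have "v = 1 - u" by simp
      ultimately show "x \<in> ?h ` ({0..1} \<times> (convex hull F))"
        by (intro image_eqI[where x = "(u, b)"]) auto
    next
      fix x
      assume "x \<in> ?h ` ({0..1} \<times> (convex hull F))"
      then obtain u b where "0 \<le> u" "u \<le> 1" "b \<in> convex hull F" "x = u *\<^sub>R f + (1 - u) *\<^sub>R b"
        by auto
      then show "x \<in> convex hull (insert f F)"
        unfolding convex_hull_insert[OF False]
        by (intro CollectI exI[of _ u] conjI exI[of _ "1 - u"] exI[of _ b]) auto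
    qed
    have cont: "continuous_on ({0..1} \<times> (convex hull F)) ?h"
    proof (rule continuous_on_coordinatewise_then_product)
      fix i
      have "continuous_on ({0..1} \<times> (convex hull F)) (\<lambda>p :: real \<times> ('x \<Rightarrow> real). snd p i)"
        by (rule continuous_on_product_then_coordinatewise[OF continuous_on_snd[OF continuous_on_id]])
      then show "continuous_on ({0..1} \<times> (convex hull F)) (\<lambda>p. ?h p i)"
        by (auto intro!: continuous_intros)
    qed
    have comp: "compact ({0..1 :: real} \<times> (convex hull F))"
      using insert.IH by (intro compact_Times compact_Icc)
    show ?thesis
      unfolding eq by (rule compact_continuous_image[OF cont comp])
  qed
qed

lemma sum_fun_apply: "(\<Sum>i\<in>X. f i) x = (\<Sum>i\<in>X. f i x)"
  by (induction X rule: infinite_finite_induct) auto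

text \<open>An entry is one nonnegative summand of the total for its pair \<open>(s, t)\<close>,
  which is 1. This limits the error made when one correlation is exchanged for another.\<close>

lemma correlation_le_1:
  assumes "finite A" "finite B" "P \<in> correlations A B S T" "x \<in> Gam A B S T"
  shows "P x \<le> 1"
proof -
  obtain a b s t where x: "x = (a, b, s, t)" "a \<in> A" "b \<in> B" "s \<in> S" "t \<in> T"
    using assms(4) by (auto simp: Gam_def)
  have nn: "0 \<le> P (a', b', s, t)" if "a' \<in> A" "b' \<in> B" for a' b'
    using that assms(3) x by (auto simp: correlations_def Gam_def)
  have "P x \<le> (\<Sum>b\<in>B. P (a, b, s, t))"
    unfolding x(1) by (rule member_le_sum) (use x nn assms in auto)
  also have "\<dots> \<le> (\<Sum>a\<in>A. \<Sum>b\<in>B. P (a, b, s, t))"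
    by (rule member_le_sum[where f = "\<lambda>a. \<Sum>b\<in>B. P (a, b, s, t)"])
      (use x nn assms in \<open>auto intro!: sum_nonneg\<close>)
  also have "\<dots> = 1"
    using assms(3) x by (auto simp: correlations_def)
  finally show ?thesis .
qed

text \<open>A product of 0/1 values is again 0 or 1, so such a \<open>P\<close> is the indicator
  function of a subset of the finite set \<open>Gam A B S T\<close>.\<close>

lemma finite_deterministic_correlations:
  assumes "finite A" "finite B" "finite S" "finite T"
  shows "finite (deterministic_correlations A B S T)"
proof (rule finite_subset)
  show "deterministic_correlations A B S T \<subseteq> indicator ` Pow (Gam A B S T)"
  proof
    fix P
    assume P: "P \<in> deterministic_correlations A B S T"
    have "P x = indicator {y \<in> Gam A B S T. P y = 1} x" for x
    proof (cases "x \<in> Gam A B S T")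
      case True
      then have "P x \<in> {0, 1}"
        using P unfolding deterministic_correlations_def Gam_def by (auto, fastforce+)
      then show ?thesis using True by auto
    next
      case False
      then show ?thesis
        using P unfolding deterministic_correlations_def correlations_def vectors_on_def
        by (elim CollectE conjE) (simp del: split_paired_All)
    qed
    then have "P = indicator {y \<in> Gam A B S T. P y = 1}"
      by (rule ext)
    moreover have "{y \<in> Gam A B S T. P y = 1} \<in> Pow (Gam A B S T)"
      by blast
    ultimately show "P \<in> indicator ` Pow (Gam A B S T)"
      by (rule image_eqI)
  qed
  show "finite (indicator ` Pow (Gam A B S T) :: ('a \<times> 'b \<times> 'c \<times> 'd \<Rightarrow> real) set)"
    using assms by (simp add: Gam_def)
qed

lemma C_loc_subset_vectors_on: "C_loc A B S T \<subseteq> vectors_on (Gam A B S T)"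
  unfolding C_loc_def
proof (rule hull_minimal)
  show "convex (vectors_on (Gam A B S T))"
    by (auto simp: convex_def vectors_on_def)
qed (auto simp: deterministic_correlations_def correlations_def)

text \<open>The l1 distance to \<open>P\<close> over \<open>Gam A B S T\<close> attains its minimum
  on the compact set \<open>C_loc A B S T\<close>, and \<open>approx\<close> forces this minimum to
  be 0. The minimiser equals \<open>P\<close> on \<open>Gam A B S T\<close>, and both functions
  vanish elsewhere.\<close>

lemma C_loc_closed_pointwise:
  assumes "finite A" "finite B" "finite S" "finite T"
    and "P \<in> vectors_on (Gam A B S T)"
    and approx: "\<And>e. 0 < e \<Longrightarrow> \<exists>R\<in>C_loc A B S T. \<forall>x\<in>Gam A B S T. \<bar>R x - P x\<bar> \<le> e"
  shows "P \<in> C_loc A B S T"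
proof -
  let ?G = "Gam A B S T"
  let ?dist = "\<lambda>R. \<Sum>x\<in>?G. \<bar>R x - P x\<bar>"
  have fin: "finite ?G"
    using assms by (simp add: Gam_def)
  have "compact (C_loc A B S T)"
    unfolding C_loc_def
    by (intro compact_convex_hull_finite_fun finite_deterministic_correlations assms)
  moreover have "C_loc A B S T \<noteq> {}"
    using approx[of 1] by auto
  moreover have "continuous_on (C_loc A B S T) ?dist"
    by (intro continuous_intros continuous_on_product_then_coordinatewise)
  ultimately obtain R where R: "R \<in> C_loc A B S T"
    and min: "\<forall>R'\<in>C_loc A B S T. ?dist R \<le> ?dist R'"
    using continuous_attains_inf[of "C_loc A B S T" ?dist] by blast
  have "?dist R \<le> e" if "0 < e" for e :: real
  proof -
    \<comment> \<open>The added 1 keeps the denominator positive when \<open>?G\<close> is empty;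
      \<open>card ?G\<close> errors of this size still add up to at most \<open>e\<close>.\<close>
    let ?e = "e / (real (card ?G) + 1)"
    have "0 < ?e" using that by (intro divide_pos_pos) auto
    then obtain R' where R': "R' \<in> C_loc A B S T" "\<forall>x\<in>?G. \<bar>R' x - P x\<bar> \<le> ?e"
      using approx by blast
    have "?dist R \<le> ?dist R'" using min R'(1) by blast
    also have "\<dots> \<le> real (card ?G) * ?e"
      by (rule sum_bounded_above) (use R'(2) in auto)
    also have "\<dots> \<le> e" using that by (simp add: field_simps)
    finally show ?thesis .
  qed
  then have "?dist R \<le> 0"
    using field_le_epsilon[of "?dist R" 0] unfolding add_0 by blast
  then have "?dist R = 0"
    by (intro antisym sum_nonneg) auto
  then have "R x = P x" if "x \<in> ?G" for x
    using that fin by (simp add: sum_nonneg_eq_0_iff)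
  moreover have "R x = P x" if "x \<notin> ?G" for x
    using that subsetD[OF C_loc_subset_vectors_on R] assms(5)
    by (simp add: vectors_on_def del: split_paired_All)
  ultimately have "R = P" by blast
  with R show ?thesis by simp
qed

section \<open>Products of local distributions as mixtures of deterministic correlations\<close>

text \<open>This is the marginal at \<open>s0\<close> of a random function with independent values.
  The indicator of the event is absorbed into the factor at \<open>s0\<close>, giving
  \<open>?q\<close>; then the sum of products factorises, and every factor other than the one at
  \<open>s0\<close> is 1.\<close>

lemma sum_PiE_prod_marginal:
  fixes p :: "'a \<Rightarrow> 's \<Rightarrow> real"
  assumes "finite A" "finite S" "\<And>s. s \<in> S \<Longrightarrow> (\<Sum>a\<in>A. p a s) = 1"
    and "s0 \<in> S" "a0 \<in> A"
  shows "(\<Sum>f\<in>S \<rightarrow>\<^sub>E A. (\<Prod>s\<in>S. p (f s) s) * of_bool (f s0 = a0)) = p a0 s0"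
proof -
  let ?q = "\<lambda>s a. p a s * (if s = s0 then of_bool (a = a0) else 1)"
  have "(\<Sum>f\<in>S \<rightarrow>\<^sub>E A. (\<Prod>s\<in>S. p (f s) s) * of_bool (f s0 = a0))
      = (\<Sum>f\<in>S \<rightarrow>\<^sub>E A. \<Prod>s\<in>S. ?q s (f s))"
    using assms by (intro sum.cong refl) (simp add: prod.distrib prod.delta')
  also have "\<dots> = (\<Prod>s\<in>S. \<Sum>a\<in>A. ?q s a)"
    using assms by (subst prod_sum_PiE) auto
  also have "\<dots> = (\<Prod>s\<in>S. if s = s0 then p a0 s0 else 1)"
    using assms by (intro prod.cong refl) (auto simp: of_bool_def if_distrib[of "(*) _"] cong: if_cong)
  also have "\<dots> = p a0 s0"
    using assms by (simp add: prod.delta')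
  finally show ?thesis .
qed

lemma sum_PiE_prod_eq_1:
  fixes p :: "'a \<Rightarrow> 's \<Rightarrow> real"
  assumes "finite A" "finite S" "\<And>s. s \<in> S \<Longrightarrow> (\<Sum>a\<in>A. p a s) = 1"
  shows "(\<Sum>f\<in>S \<rightarrow>\<^sub>E A. \<Prod>s\<in>S. p (f s) s) = 1"
  using prod_sum_PiE[of S "\<lambda>_. A" "\<lambda>s a. p a s"] assms by simp

lemma product_in_C_loc:
  fixes p :: "'a \<Rightarrow> 's \<Rightarrow> real" and q :: "'b \<Rightarrow> 't \<Rightarrow> real"
  assumes fin: "finite A" "finite B" "finite S" "finite T"
    and P0: "P \<in> vectors_on (Gam A B S T)"
    and p0: "\<And>a s. a \<in> A \<Longrightarrow> s \<in> S \<Longrightarrow> 0 \<le> p a s" and p1: "\<And>s. s \<in> S \<Longrightarrow> (\<Sum>a\<in>A. p a s) = 1"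
    and q0: "\<And>b t. b \<in> B \<Longrightarrow> t \<in> T \<Longrightarrow> 0 \<le> q b t" and q1: "\<And>t. t \<in> T \<Longrightarrow> (\<Sum>b\<in>B. q b t) = 1"
    and P: "\<And>a b s t. a \<in> A \<Longrightarrow> b \<in> B \<Longrightarrow> s \<in> S \<Longrightarrow> t \<in> T \<Longrightarrow> P (a, b, s, t) = p a s * q b t"
  shows "P \<in> C_loc A B S T"
proof -
  let ?X = "(S \<rightarrow>\<^sub>E A) \<times> (T \<rightarrow>\<^sub>E B)"
  \<comment> \<open>The probability of the pair \<open>(f, g)\<close> when all values
    \<open>f s\<close> and \<open>g t\<close> are drawn independently from \<open>p\<close> and
    \<open>q\<close>.\<close>
  define w where "w = (\<lambda>(f, g). (\<Prod>s\<in>S. p (f s) s) * (\<Prod>t\<in>T. q (g t) t))"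
  \<comment> \<open>The correlation of two players who answer \<open>f s\<close> and
    \<open>g t\<close> with certainty, cut off outside \<open>Gam A B S T\<close> so as to lie in
    \<open>vectors_on\<close>.\<close>
  define det :: "('s \<Rightarrow> 'a) \<times> ('t \<Rightarrow> 'b) \<Rightarrow> 'a \<times> 'b \<times> 's \<times> 't \<Rightarrow> real" where
    "det = (\<lambda>(f, g) (a, b, s, t). if (a, b, s, t) \<in> Gam A B S T
       then of_bool (f s = a) * of_bool (g t = b) else 0)"
  have "det h \<in> deterministic_correlations A B S T" if "h \<in> ?X" for h
  proof -
    from that obtain f g where h: "h = (f, g)" "f \<in> S \<rightarrow>\<^sub>E A" "g \<in> T \<rightarrow>\<^sub>E B"
      by auto
    have f: "(\<Sum>a\<in>A. of_bool (f s = a)) = (1 :: real)" if "s \<in> S" for s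
      using h fin that by (auto simp: of_bool_def sum.delta)
    have g: "(\<Sum>b\<in>B. of_bool (g t = b)) = (1 :: real)" if "t \<in> T" for t
      using h fin that by (auto simp: of_bool_def sum.delta)
    have "(\<Sum>a\<in>A. \<Sum>b\<in>B. det h (a, b, s, t)) = 1" if "s \<in> S" "t \<in> T" for s t
    proof -
      have "(\<Sum>a\<in>A. \<Sum>b\<in>B. det h (a, b, s, t))
          = (\<Sum>a\<in>A. \<Sum>b\<in>B. of_bool (f s = a) * of_bool (g t = b))"
        using that by (intro sum.cong refl) (simp add: det_def h Gam_def)
      also have "\<dots> = (\<Sum>a\<in>A. of_bool (f s = a)) * (\<Sum>b\<in>B. of_bool (g t = b))"
        by (simp only: sum_product)
      finally show ?thesis using f g that by simp
    qed
    moreover have "0 \<le> det h x" for x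
      by (cases x) (simp add: det_def h(1))
    ultimately have "det h \<in> correlations A B S T"
      by (auto simp: correlations_def vectors_on_def det_def h(1))
    then show ?thesis
      unfolding deterministic_correlations_def
      using f g
      by (intro CollectI conjI exI[of _ "\<lambda>a s. of_bool (f s = a)"]
          exI[of _ "\<lambda>b t. of_bool (g t = b)"])
        (auto simp: det_def h(1) Gam_def)
  qed
  then have det: "det h \<in> C_loc A B S T" if "h \<in> ?X" for h
    using that unfolding C_loc_def by (blast intro: hull_inc)
  have "(\<Sum>h\<in>?X. w h) = 1"
    using sum_PiE_prod_eq_1[OF fin(1,3) p1] sum_PiE_prod_eq_1[OF fin(2,4) q1]
    by (simp add: w_def sum.cartesian_product[symmetric] sum_product[symmetric])
  moreover have "0 \<le> w h" if "h \<in> ?X" for h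
    using that p0 q0 by (auto simp: w_def PiE_def Pi_def intro!: mult_nonneg_nonneg prod_nonneg)
  moreover have "finite ?X"
    using fin by (auto intro: finite_PiE)
  ultimately have "(\<Sum>h\<in>?X. w h *\<^sub>R det h) \<in> C_loc A B S T"
    using det by (intro convex_sum) (auto simp: C_loc_def)
  moreover have "P = (\<Sum>h\<in>?X. w h *\<^sub>R det h)"
  proof
    fix x :: "'a \<times> 'b \<times> 's \<times> 't"
    obtain a b s t where x: "x = (a, b, s, t)" by (cases x)
    show "P x = (\<Sum>h\<in>?X. w h *\<^sub>R det h) x"
    proof (cases "x \<in> Gam A B S T")
      case False
      then have "det h x = 0" for h
        by (simp add: det_def x split: prod.split)
      then show ?thesis
        using False P0 by (simp add: vectors_on_def sum_fun_apply del: split_paired_All)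
    next
      case True
      then have m: "a \<in> A" "b \<in> B" "s \<in> S" "t \<in> T"
        by (auto simp: x Gam_def)
      \<comment> \<open>Both the weight and the indicator split into an \<open>f\<close> part and a
        \<open>g\<close> part, so the mixture at \<open>x\<close> is a product of two
        marginals.\<close>
      have "(\<Sum>h\<in>?X. w h *\<^sub>R det h) x =
          (\<Sum>f\<in>S \<rightarrow>\<^sub>E A. \<Sum>g\<in>T \<rightarrow>\<^sub>E B. ((\<Prod>s\<in>S. p (f s) s) * of_bool (f s = a))
             * ((\<Prod>t\<in>T. q (g t) t) * of_bool (g t = b)))"
        unfolding sum_fun_apply sum.cartesian_product
        using True by (intro sum.cong refl) (auto simp: w_def det_def x)
      also have "\<dots> = p a s * q b t"
        unfolding sum_product[symmetric]
        using sum_PiE_prod_marginal[OF fin(1,3) p1 m(3,1)]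
          sum_PiE_prod_marginal[OF fin(2,4) q1 m(4,2)] by simp
      finally show ?thesis using P m by (simp add: x)
    qed
  qed
  ultimately show ?thesis by simp
qed

section \<open>Quantum models of local dimension one\<close>

text \<open>Evaluating the form at the vector with entry 1 returns the single entry of
  \<open>M\<close>, which is therefore real and nonnegative. Conversely the form at \<open>v\<close>
  is \<open>m\<close> times the squared modulus of the entry of \<open>v\<close>.\<close>

lemma hermitian_psd_1_iff:
  "hermitian_psd 1 M \<longleftrightarrow> (\<exists>m\<ge>0. M = mat 1 1 (\<lambda>_. complex_of_real m))"
proof
  assume M: "hermitian_psd 1 M"
  then have c: "M \<in> carrier_mat 1 1" by (simp add: hermitian_psd_def)
  have "0 \<le> (M *\<^sub>v vec 1 (\<lambda>_. 1)) \<bullet>c vec 1 (\<lambda>_. 1)"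
    using M by (auto simp: hermitian_psd_def)
  then have "0 \<le> M $$ (0, 0)"
    using c by (simp add: scalar_prod_def)
  then have "0 \<le> Re (M $$ (0, 0))" "M $$ (0, 0) = complex_of_real (Re (M $$ (0, 0)))"
    by (auto simp: less_eq_complex_def complex_eq_iff)
  with c show "\<exists>m\<ge>0. M = mat 1 1 (\<lambda>_. complex_of_real m)"
    by (intro exI[of _ "Re (M $$ (0, 0))"]) auto
next
  assume "\<exists>m\<ge>0. M = mat 1 1 (\<lambda>_. complex_of_real m)"
  then obtain m where m: "0 \<le> m" "M = mat 1 1 (\<lambda>_. complex_of_real m)" by blast
  have "0 \<le> (M *\<^sub>v v) \<bullet>c v" if "v \<in> carrier_vec 1" for v
  proof -
    have "(M *\<^sub>v v) \<bullet>c v = complex_of_real (m * (cmod (vec_index v 0))\<^sup>2)"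
      using that by (simp add: m(2) scalar_prod_def complex_norm_square[symmetric] mult.assoc
          del: of_real_power)
    then show ?thesis using m(1) by (simp add: less_eq_complex_def)
  qed
  moreover have "mat_adjoint M = M"
    by (rule eq_matI) (auto simp: m(2) mat_adjoint_def mat_of_rows_def)
  ultimately show "hermitian_psd 1 M"
    by (simp add: hermitian_psd_def m(2))
qed

text \<open>One-dimensional POVMs are probability distributions; this translation serves both to
  extract local distributions from a quantum model and to build a model from them.\<close>

lemma povm_1_iff:
  "povm 1 X E \<longleftrightarrow> (\<exists>e. (\<forall>x\<in>X. 0 \<le> e x \<and> E x = mat 1 1 (\<lambda>_. complex_of_real (e x))) \<and> sum e X = 1)"
proof -
  have sum: "mat 1 1 (\<lambda>ij. \<Sum>x\<in>X. E x $$ ij) = 1\<^sub>m 1 \<longleftrightarrow> sum e X = 1"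
    if "\<forall>x\<in>X. 0 \<le> e x \<and> E x = mat 1 1 (\<lambda>_. complex_of_real (e x))" for e
  proof -
    have "(\<Sum>x\<in>X. E x $$ (0, 0)) = complex_of_real (sum e X)"
      using that by simp
    then have "(\<Sum>x\<in>X. E x $$ (0, 0)) = 1 \<longleftrightarrow> sum e X = 1"
      by (simp only: of_real_eq_1_iff)
    then show ?thesis by (auto simp: mat_eq_iff)
  qed
  show ?thesis
  proof
    assume "povm 1 X E"
    then have "\<forall>x\<in>X. \<exists>m. 0 \<le> m \<and> E x = mat 1 1 (\<lambda>_. complex_of_real m)"
      and one: "mat 1 1 (\<lambda>ij. \<Sum>x\<in>X. E x $$ ij) = 1\<^sub>m 1"
      unfolding povm_def hermitian_psd_1_iff by blast+
    then obtain e where "\<forall>x\<in>X. 0 \<le> e x \<and> E x = mat 1 1 (\<lambda>_. complex_of_real (e x))"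
      unfolding bchoice_iff by blast
    with sum one show "\<exists>e. (\<forall>x\<in>X. 0 \<le> e x \<and> E x = mat 1 1 (\<lambda>_. complex_of_real (e x))) \<and> sum e X = 1"
      by blast
  next
    assume "\<exists>e. (\<forall>x\<in>X. 0 \<le> e x \<and> E x = mat 1 1 (\<lambda>_. complex_of_real (e x))) \<and> sum e X = 1"
    then show "povm 1 X E"
      unfolding povm_def hermitian_psd_1_iff using sum by blast
  qed
qed

lemma tensor_mat_1_quadratic_form:
  assumes "\<psi> \<in> carrier_vec 1"
  shows "(tensor_mat (mat 1 1 (\<lambda>_. e)) (mat 1 1 (\<lambda>_. f)) *\<^sub>v \<psi>) \<bullet>c \<psi> = e * f * (\<psi> \<bullet>c \<psi>)"
  using assms by (simp add: tensor_mat_def scalar_prod_def)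

text \<open>In dimension one the measurement operators act as scalars and \<open>\<psi>\<close> is a
  unit vector, so the probabilities factor into one local distribution per player, and
  \<open>product_in_C_loc\<close> applies.\<close>

lemma C_qd_1_subset_C_loc:
  assumes "finite A" "finite B" "finite S" "finite T"
  shows "C_qd 1 A B S T \<subseteq> C_loc A B S T"
proof
  fix P
  assume P: "P \<in> C_qd 1 A B S T"
  then obtain \<psi> E F where psi: "\<psi> \<in> carrier_vec 1" "\<psi> \<bullet>c \<psi> = 1"
    and E: "\<forall>s\<in>S. povm 1 A (E s)" and F: "\<forall>t\<in>T. povm 1 B (F t)"
    and PE: "\<forall>a\<in>A. \<forall>b\<in>B. \<forall>s\<in>S. \<forall>t\<in>T.
          complex_of_real (P (a, b, s, t)) = (tensor_mat (E s a) (F t b) *\<^sub>v \<psi>) \<bullet>c \<psi>"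
    unfolding C_qd_def by auto
  from E obtain e where e: "\<And>s a. s \<in> S \<Longrightarrow> a \<in> A \<Longrightarrow> 0 \<le> e s a \<and> E s a = mat 1 1 (\<lambda>_. complex_of_real (e s a))"
    "\<And>s. s \<in> S \<Longrightarrow> sum (e s) A = 1"
    unfolding povm_1_iff bchoice_iff by blast
  from F obtain f where f: "\<And>t b. t \<in> T \<Longrightarrow> b \<in> B \<Longrightarrow> 0 \<le> f t b \<and> F t b = mat 1 1 (\<lambda>_. complex_of_real (f t b))"
    "\<And>t. t \<in> T \<Longrightarrow> sum (f t) B = 1"
    unfolding povm_1_iff bchoice_iff by blast
  have "P (a, b, s, t) = e s a * f t b" if "a \<in> A" "b \<in> B" "s \<in> S" "t \<in> T" for a b s t
  proof -
    have "complex_of_real (P (a, b, s, t)) = complex_of_real (e s a * f t b)"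
      using PE that e(1) f(1) tensor_mat_1_quadratic_form[OF psi(1)] psi(2) by simp
    then show ?thesis by (simp only: of_real_eq_iff)
  qed
  moreover have "P \<in> vectors_on (Gam A B S T)"
    using P by (simp add: C_qd_def correlations_def)
  ultimately show "P \<in> C_loc A B S T"
    using e f assms
    by (intro product_in_C_loc[where p = "\<lambda>a s. e s a" and q = "\<lambda>b t. f t b"]) auto
qed

text \<open>The local 0/1 distributions, read as 1 by 1 matrices, are the measurements, and the
  state is the vector with entry 1.\<close>

lemma deterministic_subset_C_qd_1: "deterministic_correlations A B S T \<subseteq> C_qd 1 A B S T"
proof
  fix P
  assume P: "P \<in> deterministic_correlations A B S T"
  then obtain PA PB where
    PA: "\<forall>s\<in>S. \<forall>a\<in>A. PA a s \<in> {0, 1 :: real}" "\<forall>s\<in>S. (\<Sum>a\<in>A. PA a s) = 1" and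
    PB: "\<forall>t\<in>T. \<forall>b\<in>B. PB b t \<in> {0, 1 :: real}" "\<forall>t\<in>T. (\<Sum>b\<in>B. PB b t) = 1" and
    PAB: "\<forall>a\<in>A. \<forall>b\<in>B. \<forall>s\<in>S. \<forall>t\<in>T. P (a, b, s, t) = PA a s * PB b t"
    unfolding deterministic_correlations_def by blast
  let ?E = "\<lambda>s a. mat 1 1 (\<lambda>_. complex_of_real (PA a s))"
  let ?F = "\<lambda>t b. mat 1 1 (\<lambda>_. complex_of_real (PB b t))"
  let ?psi = "vec 1 (\<lambda>_. 1 :: complex)"
  have "povm 1 A (?E s)" if "s \<in> S" for s
    unfolding povm_1_iff using PA that by (intro exI[of _ "\<lambda>a. PA a s"]) fastforce
  moreover have "povm 1 B (?F t)" if "t \<in> T" for t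
    unfolding povm_1_iff using PB that by (intro exI[of _ "\<lambda>b. PB b t"]) fastforce
  moreover have psi: "?psi \<in> carrier_vec 1" "?psi \<bullet>c ?psi = 1"
    by (auto simp: scalar_prod_def)
  moreover have "complex_of_real (P (a, b, s, t)) = (tensor_mat (?E s a) (?F t b) *\<^sub>v ?psi) \<bullet>c ?psi"
    if "a \<in> A" "b \<in> B" "s \<in> S" "t \<in> T" for a b s t
    unfolding tensor_mat_1_quadratic_form[OF psi(1)] psi(2) using PAB that by simp
  moreover have "P \<in> correlations A B S T"
    using P by (simp add: deterministic_correlations_def)
  ultimately show "P \<in> C_qd 1 A B S T"
    unfolding C_qd_def
    by (intro CollectI conjI exI[of _ ?psi] exI[of _ ?E] exI[of _ ?F] ballI) simp_all
qed

section \<open>Values of \<open>D_q\<close> and bounds on \<open>A_q\<close>\<close>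

lemma D_q_attained:
  assumes "P \<in> C_q A B S T"
  obtains d where "1 \<le> d" "D_q A B S T P = d\<^sup>2" "P \<in> C_qd d A B S T"
proof -
  have "\<exists>n d. n = d\<^sup>2 \<and> P \<in> C_qd d A B S T"
    using assms by (auto simp: C_q_def)
  then have "\<exists>d. D_q A B S T P = d\<^sup>2 \<and> P \<in> C_qd d A B S T"
    unfolding D_q_def by (rule LeastI_ex)
  \<comment> \<open>A vector of length 0 has inner product 0 with itself, so it is no unit
    vector.\<close>
  moreover have "P \<notin> C_qd 0 A B S T"
    by (auto simp: C_qd_def scalar_prod_def)
  ultimately show ?thesis
    using that by (metis One_nat_def Suc_leI bot_nat_0.not_eq_extremum)
qed

text \<open>The value is the square of a positive integer, hence the gap between 1 and 4 that later
  bounds the weight of expensive components.\<close>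

lemma D_q_cases:
  assumes "P \<in> C_q A B S T"
  obtains "D_q A B S T P = 1" "P \<in> C_qd 1 A B S T" | "4 \<le> D_q A B S T P"
proof -
  obtain d where d: "1 \<le> d" "D_q A B S T P = d\<^sup>2" "P \<in> C_qd d A B S T"
    using D_q_attained assms by blast
  consider "d = 1" | "2 \<le> d" using d(1) by linarith
  then show ?thesis
  proof cases
    case 1
    then show ?thesis using that(1) d by simp
  next
    case 2
    then have "2\<^sup>2 \<le> d\<^sup>2" by (rule power_mono) simp
    then show ?thesis using that(2) d by simp
  qed
qed

lemma D_q_eq_1:
  assumes "P \<in> C_qd 1 A B S T"
  shows "D_q A B S T P = 1"
proof -
  have "D_q A B S T P \<le> 1"
    unfolding D_q_def using assms by (intro Least_le exI[of _ 1]) simp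
  moreover have "P \<in> C_q A B S T" using assms unfolding C_q_def by blast
  ultimately show ?thesis by (elim D_q_cases) auto
qed

text \<open>Every \<open>D_q\<close> that occurs is at least 1, hence so is every weighted average;
  with no decomposition at all the infimum is \<open>\<infinity>\<close>.\<close>

lemma A_q_ge_1: "1 \<le> A_q A B S T P"
  unfolding A_q_def
proof (rule Inf_greatest, safe)
  fix I :: nat and lam :: "nat \<Rightarrow> real" and Q
  assume lam: "\<forall>i<I. 0 \<le> lam i" "(\<Sum>i<I. lam i) = 1" and Q: "\<forall>i<I. Q i \<in> C_q A B S T"
  have "1 \<le> D_q A B S T (Q i)" if "i < I" for i
    using Q[rule_format, OF that] by (rule D_q_cases) auto
  then have "lam i * 1 \<le> lam i * real (D_q A B S T (Q i))" if "i < I" for i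
    using that lam by (intro mult_left_mono) auto
  then have "(\<Sum>i<I. lam i) \<le> (\<Sum>i<I. lam i * real (D_q A B S T (Q i)))"
    by (intro sum_mono) simp
  then show "1 \<le> ereal (\<Sum>i<I. lam i * real (D_q A B S T (Q i)))"
    using lam by simp
qed

text \<open>A convex combination of deterministic correlations is itself an admissible
  decomposition, and each of its components has \<open>D_q\<close> equal to 1.\<close>

lemma A_q_le_1_if_C_loc:
  assumes "P \<in> C_loc A B S T"
  shows "A_q A B S T P \<le> 1"
proof -
  obtain I u x where ux: "\<forall>i\<in>{1::nat..I}. 0 \<le> u i \<and> x i \<in> deterministic_correlations A B S T"
    "sum u {1..I} = 1" "(\<Sum>i\<in>{1..I}. u i *\<^sub>R x i) = P"
    using assms unfolding C_loc_def convex_hull_indexed by blast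
  \<comment> \<open>The indices of \<open>convex_hull_indexed\<close> start at 1, those in
    \<open>A_q\<close> at 0.\<close>
  let ?lam = "\<lambda>i. u (Suc i)" and ?Q = "\<lambda>i. x (Suc i)"
  have Q: "?Q i \<in> C_qd 1 A B S T" if "i < I" for i
    using ux(1) that deterministic_subset_C_qd_1 by force
  have lam: "(\<Sum>i<I. ?lam i) = 1" "P = (\<Sum>i<I. ?lam i *\<^sub>R ?Q i)"
    using ux(2,3) sum.atLeast1_atMost_eq[of u I] sum.atLeast1_atMost_eq[of "\<lambda>i. u i *\<^sub>R x i" I]
    by simp_all
  have "(\<Sum>i<I. ?lam i * real (D_q A B S T (?Q i))) = 1"
    using lam(1) D_q_eq_1[OF Q] by simp
  then have "1 = ereal (\<Sum>i<I. ?lam i * real (D_q A B S T (?Q i)))"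
    by simp
  moreover have "\<forall>i<I. 0 \<le> ?lam i" using ux(1) by simp
  moreover have "\<forall>i<I. ?Q i \<in> C_q A B S T" using Q unfolding C_q_def by blast
  ultimately show ?thesis
    unfolding A_q_def using lam by (intro Inf_lower CollectI exI conjI)
qed

section \<open>Classical approximation from a small average dimension\<close>

text \<open>In a decomposition that is nearly optimal, the components without a one-dimensional
  model carry little weight. Replacing each of them by one fixed component that has such a model
  yields a point of \<open>C_loc A B S T\<close>, and no entry moves by more than that
  weight.\<close>

lemma C_loc_approx_if_A_q_le_1:
  assumes fin: "finite A" "finite B" "finite S" "finite T"
    and "A_q A B S T P \<le> 1" and "0 < e"
  shows "\<exists>R\<in>C_loc A B S T. \<forall>x\<in>Gam A B S T. \<bar>R x - P x\<bar> \<le> e"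
proof -
  \<comment> \<open>The cap at 1 keeps the weight of the bad components below 1/3, so that not all
    components can be bad.\<close>
  define \<epsilon> where "\<epsilon> = min e 1"
  have eps: "0 < \<epsilon>" "\<epsilon> \<le> 1" "\<epsilon> \<le> e" using assms(6) by (auto simp: \<epsilon>_def)
  have "A_q A B S T P < ereal (1 + \<epsilon>)"
    by (rule le_less_trans[OF assms(5)]) (use eps in simp)
  then obtain v where v: "v < ereal (1 + \<epsilon>)"
    and "\<exists>(I :: nat) lam Q. v = ereal (\<Sum>i<I. lam i * real (D_q A B S T (Q i))) \<and>
       (\<forall>i<I. 0 \<le> lam i) \<and> (\<Sum>i<I. lam i) = 1 \<and>
       P = (\<Sum>i<I. lam i *\<^sub>R Q i) \<and> (\<forall>i<I. Q i \<in> C_q A B S T)"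
    unfolding A_q_def Inf_less_iff by blast
  from this(2) obtain I :: nat and lam Q
    where dec: "v = ereal (\<Sum>i<I. lam i * real (D_q A B S T (Q i))) \<and>
       (\<forall>i<I. 0 \<le> lam i) \<and> (\<Sum>i<I. lam i) = 1 \<and>
       P = (\<Sum>i<I. lam i *\<^sub>R Q i) \<and> (\<forall>i<I. Q i \<in> C_q A B S T)"
    by (elim exE)
  then have lam: "\<forall>i<I. 0 \<le> lam i" "(\<Sum>i<I. lam i) = 1"
    and P: "P = (\<Sum>i<I. lam i *\<^sub>R Q i)" and Q: "\<forall>i<I. Q i \<in> C_q A B S T"
    by simp_all
  from v dec have lt: "(\<Sum>i<I. lam i * real (D_q A B S T (Q i))) < 1 + \<epsilon>"
    by simp
  define bad where "bad i \<longleftrightarrow> Q i \<notin> C_qd 1 A B S T" for i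
  \<comment> \<open>Every component costs at least 1 and a bad one at least 4 = 1 + 3; summing
    isolates three times the bad weight.\<close>
  have "lam i * (1 + 3 * of_bool (bad i)) \<le> lam i * real (D_q A B S T (Q i))" if "i < I" for i
  proof (rule mult_left_mono)
    have "Q i \<in> C_q A B S T" using Q that by blast
    then show "1 + 3 * of_bool (bad i) \<le> real (D_q A B S T (Q i))"
      by (rule D_q_cases) (auto simp: bad_def)
  qed (use lam that in auto)
  then have "(\<Sum>i<I. lam i * (1 + 3 * of_bool (bad i))) < 1 + \<epsilon>"
    by (intro le_less_trans[OF sum_mono lt]) auto
  moreover have "(\<Sum>i<I. lam i * (1 + 3 * of_bool (bad i))) = 1 + 3 * (\<Sum>i<I. lam i * of_bool (bad i))"
    by (simp only: distrib_left mult_1_right sum.distrib sum_distrib_left mult.left_commute lam(2))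
  ultimately have weight: "3 * (\<Sum>i<I. lam i * of_bool (bad i)) < \<epsilon>" by simp
  obtain j where j: "j < I" "\<not> bad j"
  proof (rule ccontr)
    assume "\<not> thesis"
    then have "\<forall>i<I. bad i" using that by blast
    then have "(\<Sum>i<I. lam i * of_bool (bad i)) = 1" using lam(2) by simp
    then show False using weight eps by simp
  qed
  \<comment> \<open>The weights \<open>lam\<close> stay as they are, so the new sum is still a
    convex combination.\<close>
  define Q' where "Q' i = (if bad i then Q j else Q i)" for i
  have "Q' i \<in> C_loc A B S T" if "i < I" for i
    using C_qd_1_subset_C_loc[OF fin] j by (auto simp: Q'_def bad_def)
  then have "(\<Sum>i<I. lam i *\<^sub>R Q' i) \<in> C_loc A B S T"
    using lam by (intro convex_sum) (auto simp: C_loc_def)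
  moreover have "\<bar>(\<Sum>i<I. lam i *\<^sub>R Q' i) x - P x\<bar> \<le> e" if x: "x \<in> Gam A B S T" for x
  proof -
    have bnd: "0 \<le> Q i x \<and> Q i x \<le> 1" if "i < I" for i
    proof -
      have "Q i \<in> correlations A B S T" using Q that by (auto simp: C_q_def C_qd_def)
      then show ?thesis
        using correlation_le_1[OF fin(1,2) _ x] x by (simp add: correlations_def)
    qed
    have "(\<Sum>i<I. lam i *\<^sub>R Q' i) x - P x = (\<Sum>i<I. lam i * (Q' i x - Q i x))"
      by (simp add: P sum_fun_apply right_diff_distrib sum_subtractf)
    also have "\<bar>\<dots>\<bar> \<le> (\<Sum>i<I. lam i * of_bool (bad i))"
    proof (rule order_trans[OF sum_abs sum_mono])
      fix i
      assume i: "i \<in> {..<I}"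
      \<comment> \<open>For a bad \<open>i\<close> this compares two numbers between 0 and 1;
        otherwise the difference is 0.\<close>
      then have "\<bar>Q' i x - Q i x\<bar> \<le> of_bool (bad i)"
        using bnd[of i] bnd[of j] j(1) by (auto simp: Q'_def)
      then show "\<bar>lam i * (Q' i x - Q i x)\<bar> \<le> lam i * of_bool (bad i)"
        unfolding abs_mult using lam(1) i by (simp add: mult_left_mono)
    qed
    also have "\<dots> \<le> e"
    proof -
      have "0 \<le> (\<Sum>i<I. lam i * of_bool (bad i))"
        using lam(1) by (intro sum_nonneg) auto
      then show ?thesis using weight eps by linarith
    qed
    finally show ?thesis .
  qed
  ultimately show ?thesis by blast
qed

theorem proposition2p2:
  fixes A :: "'a set" and B :: "'b set" and S :: "'s set" and T :: "'t set"
    and P :: "'a \<times> 'b \<times> 's \<times> 't \<Rightarrow> real"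
  assumes "finite A" and "finite B" and "finite S" and "finite T"
    and "P \<in> correlations A B S T"
  shows "A_q A B S T P = 1 \<longleftrightarrow> P \<in> C_loc A B S T"
proof
  assume "A_q A B S T P = 1"
  then have "\<exists>R\<in>C_loc A B S T. \<forall>x\<in>Gam A B S T. \<bar>R x - P x\<bar> \<le> e" if "0 < e" for e
    using that assms by (intro C_loc_approx_if_A_q_le_1) auto
  then show "P \<in> C_loc A B S T"
    using assms by (intro C_loc_closed_pointwise) (auto simp: correlations_def)
next
  assume "P \<in> C_loc A B S T"
  then show "A_q A B S T P = 1"
    by (intro antisym A_q_le_1_if_C_loc A_q_ge_1)
qed

end
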